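(* Let $k\ge 1$ and $\ell$ be integers and $n\ge 1$ an integer satisfying one of: (1) $\ell\in[0,k]$ and $n\ge 1$; (2) $\ell\in(k,\tfrac32 k)$ and $n\ge 2$; (3) $\ell\in[\tfrac32 k,2k)$ and either $n=2$ or $n\ge \frac{\ell}{2k-\ell}$. Let $K$ be the complete multigraph on the vertex set $\{1,\dots,n\}$ having $\max\{0,k-\ell\}$ loops at each vertex and $2k-\ell$ parallel edges between each pair of distinct vertices. Then the collection of edge sets of all $(k,\ell)$-tight graphs on the vertex set $\{1,\dots,n\}$ whose edges are edges of $K$ is the set of bases of a matroid on the ground set $E(K)$.
   Context: All graphs are finite multigraphs (loops and parallel edges allowed). For a graph $G=(V,E)$ with $n=|V|$ and $m=|E|$, $G$ is $(k,\ell)$-sparse if every subset $V'\subseteq V$ with $n'=|V'|$ vertices spans (induces) at most $\max\{0,kn'-\ell\}$ edges (loops included). $G$ is $(k,\ell)$-tight if it is $(k,\ell)$-sparse and $m=kn-\ell$. *)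

theory Defs
  imports Complex_Main
begin

record ('v, 'e) multigraph =
  verts :: "'v set"
  edges :: "'e set"
  ends :: "'e \<Rightarrow> 'v set"

(* Undirected finite multigraphs: an edge with one end is a loop, and distinct edges may have the
   same ends. The value of ends outside the edge set is irrelevant. *)
definition finite_multigraph :: "('v, 'e) multigraph \<Rightarrow> bool" where
  "finite_multigraph G \<longleftrightarrow> finite (verts G) \<and> finite (edges G) \<and>
     (\<forall>e \<in> edges G. ends G e \<subseteq> verts G \<and> card (ends G e) \<in> {1, 2})"

definition spanned_edges :: "('v, 'e) multigraph \<Rightarrow> 'v set \<Rightarrow> 'e set" where
  "spanned_edges G V' = {e \<in> edges G. ends G e \<subseteq> V'}"

definition sparse :: "int \<Rightarrow> int \<Rightarrow> ('v, 'e) multigraph \<Rightarrow> bool" where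
  "sparse k l G \<longleftrightarrow>
     (\<forall>V' \<subseteq> verts G. int (card (spanned_edges G V')) \<le> max 0 (k * int (card V') - l))"

definition tight :: "int \<Rightarrow> int \<Rightarrow> ('v, 'e) multigraph \<Rightarrow> bool" where
  "tight k l G \<longleftrightarrow> sparse k l G \<and> int (card (edges G)) = k * int (card (verts G)) - l"

(* An edge of the complete multigraph is its set of ends together with a number that tells
   parallel copies apart. The conversion nat truncates, so nat (k - l) is max 0 (k - l). *)
definition complete_multigraph :: "int \<Rightarrow> int \<Rightarrow> nat \<Rightarrow> (nat, nat set \<times> nat) multigraph" where
  "complete_multigraph k l n =
     \<lparr> verts = {1..n},
       edges = {({v}, i) | v i. v \<in> {1..n} \<and> i < nat (k - l)}
             \<union> {({u, v}, i) | u v i. u \<in> {1..n} \<and> v \<in> {1..n} \<and> u \<noteq> v \<and> i < nat (2 * k - l)},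
       ends = fst \<rparr>"

lemma finite_multigraph_complete: "finite_multigraph (complete_multigraph k l n)"
proof -
  have "edges (complete_multigraph k l n) \<subseteq> Pow {1..n} \<times> {..<nat (k - l) + nat (2 * k - l)}"
    by (auto simp: complete_multigraph_def)
  then have "finite (edges (complete_multigraph k l n))"
    by (rule finite_subset) simp
  then show ?thesis
    by (auto simp: finite_multigraph_def complete_multigraph_def)
qed

lemma card_loops_complete:
  assumes "v \<in> {1..n}"
  shows "int (card {e \<in> edges (complete_multigraph k l n). ends (complete_multigraph k l n) e = {v}})
    = max 0 (k - l)"
proof -
  have "{e \<in> edges (complete_multigraph k l n). ends (complete_multigraph k l n) e = {v}}
    = Pair {v} ` {..<nat (k - l)}"
    using assms by (auto simp: complete_multigraph_def doubleton_eq_iff)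
  then show ?thesis by (simp add: card_image inj_on_def)
qed

lemma card_parallel_complete:
  assumes "u \<in> {1..n}" "v \<in> {1..n}" "u \<noteq> v" "l \<le> 2 * k"
  shows "int (card {e \<in> edges (complete_multigraph k l n). ends (complete_multigraph k l n) e = {u, v}})
    = 2 * k - l"
proof -
  have "{e \<in> edges (complete_multigraph k l n). ends (complete_multigraph k l n) e = {u, v}}
    = Pair {u, v} ` {..<nat (2 * k - l)}"
    (is "?L = ?R")
  proof
    show "?L \<subseteq> ?R"
      using assms by (auto simp: complete_multigraph_def doubleton_eq_iff)
    show "?R \<subseteq> ?L"
      using assms(1-3) by (simp add: complete_multigraph_def image_subset_iff) blast
  qed
  then show ?thesis using assms by (simp add: card_image inj_on_def)
qed

definition matroid :: "'e set \<Rightarrow> 'e set set \<Rightarrow> bool" where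
  "matroid E \<I> \<longleftrightarrow>
     finite E \<and> \<I> \<subseteq> Pow E \<and> {} \<in> \<I> \<and>
     (\<forall>X \<in> \<I>. \<forall>Y. Y \<subseteq> X \<longrightarrow> Y \<in> \<I>) \<and>
     (\<forall>X \<in> \<I>. \<forall>Y \<in> \<I>. card X < card Y \<longrightarrow> (\<exists>e \<in> Y - X. insert e X \<in> \<I>))"

definition matroid_bases :: "'e set set \<Rightarrow> 'e set set" where
  "matroid_bases \<I> = {B \<in> \<I>. \<forall>X \<in> \<I>. B \<subseteq> X \<longrightarrow> X = B}"

definition subgraph_on :: "'v set \<Rightarrow> ('v, 'e) multigraph \<Rightarrow> ('v, 'e) multigraph \<Rightarrow> bool" where
  "subgraph_on V G K \<longleftrightarrow> finite_multigraph G \<and> verts G = V \<and> edges G \<subseteq> edges K \<and>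
     (\<forall>e \<in> edges G. ends G e = ends K e)"

end

theory Submission imports Defs begin

text \<open>The sparse edge sets are the independent sets. Given a sparse set \<open>X\<close>, call a vertex set \<open>V\<close>
  with \<open>l < k|V|\<close> saturated if \<open>X\<close> spans exactly \<open>k|V| - l\<close> edges on it. By submodularity, maximal
  saturated sets (blocks) never span a common edge, and an edge that cannot be added to \<open>X\<close> is spanned
  by a block. A sparse \<open>Y\<close> has no more edges than \<open>X\<close> inside each block, which gives augmentation.

  If \<open>X\<close> is a maximal sparse set in the complete multigraph, then every pair of vertices lies in
  a block. For \<open>l < k\<close> blocks are disjoint, so there is only one. For \<open>k \<le> l\<close> the blocks form a linear space:
  with block sizes \<open>t\<close> one has \<open>\<Sum> t(t - 1) = n(n - 1)\<close> and \<open>|X| = \<Sum> (kt - l)\<close>. Writing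
  \<open>p = 2k - l\<close>, the excess \<open>|X| - (kn - l)\<close> equals \<open>k(\<Sum> (t - 2) - (n - 2)) + p(r - 1)\<close> for \<open>r\<close> blocks.
  If the coefficient of \<open>k\<close> is negative, then the lower bound on \<open>n\<close>, in the form \<open>2k \<le> p(n + 1)\<close>, together
  with \<open>(n + 1)(t - 2) \<ge> (t + 1)(t - 2)\<close> again gives an excess of at least \<open>0\<close>.\<close>

section \<open>Sparse edge sets and their blocks\<close>

locale sparsity =
  fixes K :: "('v, 'e) multigraph" and k l :: int
  assumes finite_K: "finite_multigraph K"
    and l_nonneg: "0 \<le> l" and k_nonneg: "0 \<le> k"
    and edge_large: "e \<in> edges K \<Longrightarrow> l < k * int (card (ends K e))"
begin

definition spanned :: "'e set \<Rightarrow> 'v set \<Rightarrow> 'e set" where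
  "spanned X V = {e \<in> X. ends K e \<subseteq> V}"

definition indep :: "'e set \<Rightarrow> bool" where
  "indep X \<longleftrightarrow> X \<subseteq> edges K \<and>
     (\<forall>V \<subseteq> verts K. int (card (spanned X V)) \<le> max 0 (k * int (card V) - l))"

text \<open>The strict inequality forces a saturated set to span an edge of \<open>X\<close>; when
  \<open>k \<le> l\<close> it leaves only sets with at least two vertices.\<close>

definition saturated :: "'e set \<Rightarrow> 'v set \<Rightarrow> bool" where
  "saturated X V \<longleftrightarrow> V \<subseteq> verts K \<and> l < k * int (card V) \<and>
     int (card (spanned X V)) = k * int (card V) - l"

definition blocks :: "'e set \<Rightarrow> 'v set set" where
  "blocks X = {V. saturated X V \<and> (\<forall>W. saturated X W \<and> V \<subseteq> W \<longrightarrow> W = V)}"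

lemma finite_verts: "finite (verts K)" and finite_edges: "finite (edges K)"
  and ends_subset: "e \<in> edges K \<Longrightarrow> ends K e \<subseteq> verts K"
  using finite_K by (auto simp: finite_multigraph_def)

text \<open>Together with \<open>edge_large\<close>, this confines the truncation of the bound at 0
  to vertex sets that span no edge of \<open>K\<close>.\<close>

lemma large_mono:
  assumes "l < k * int (card U)" "U \<subseteq> V" "V \<subseteq> verts K"
  shows "l < k * int (card V)"
proof -
  have "card U \<le> card V"
    using assms finite_verts by (meson card_mono finite_subset)
  then have "k * int (card U) \<le> k * int (card V)"
    using k_nonneg by (simp add: mult_left_mono)
  with assms(1) show ?thesis by simp
qed

lemma finite_spanned: "X \<subseteq> edges K \<Longrightarrow> finite (spanned X V)"
  by (rule finite_subset[OF _ finite_edges]) (auto simp: spanned_def)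

lemma indep_bound:
  assumes "indep X" "V \<subseteq> verts K" "l < k * int (card V)"
  shows "int (card (spanned X V)) \<le> k * int (card V) - l"
proof -
  have "int (card (spanned X V)) \<le> max 0 (k * int (card V) - l)"
    using assms unfolding indep_def by blast
  with assms(3) show ?thesis by simp
qed

lemma indep_subset:
  assumes "indep X" "Y \<subseteq> X"
  shows "indep Y"
  unfolding indep_def
proof (intro conjI allI impI)
  show "Y \<subseteq> edges K" using assms by (auto simp: indep_def)
  fix V assume V: "V \<subseteq> verts K"
  have "card (spanned Y V) \<le> card (spanned X V)"
    using assms by (intro card_mono finite_spanned) (auto simp: spanned_def indep_def)
  moreover have "int (card (spanned X V)) \<le> max 0 (k * int (card V) - l)"
    using assms V unfolding indep_def by blast
  ultimately show "int (card (spanned Y V)) \<le> max 0 (k * int (card V) - l)"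
    by linarith
qed

text \<open>The spanned edge count is supermodular and k|V| is modular. By \<open>AB\<close> the
  untruncated bound holds on the intersection as well as on the union, so equality for
  \<open>A\<close> and \<open>B\<close> forces equality for their union.\<close>

lemma saturated_Un:
  assumes X: "indep X" and A: "saturated X A" and B: "saturated X B"
    and AB: "l < k * int (card (A \<inter> B))"
  shows "saturated X (A \<union> B)"
proof -
  have sub: "A \<subseteq> verts K" "B \<subseteq> verts K" and XK: "X \<subseteq> edges K"
    using assms by (auto simp: saturated_def indep_def)
  then have fin: "finite A" "finite B"
    using finite_verts finite_subset by blast+
  have large: "l < k * int (card (A \<union> B))"
    using large_mono[OF AB, of "A \<union> B"] sub by blast
  have "card (spanned X A) + card (spanned X B)
      = card (spanned X A \<union> spanned X B) + card (spanned X A \<inter> spanned X B)"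
    using finite_spanned[OF XK] by (intro card_Un_Int)
  also have "spanned X A \<inter> spanned X B = spanned X (A \<inter> B)"
    by (auto simp: spanned_def)
  also have "card (spanned X A \<union> spanned X B) \<le> card (spanned X (A \<union> B))"
    using finite_spanned[OF XK] by (intro card_mono) (auto simp: spanned_def)
  finally have "card (spanned X A) + card (spanned X B)
      \<le> card (spanned X (A \<union> B)) + card (spanned X (A \<inter> B))" by simp
  moreover have "int (card (spanned X (A \<inter> B))) \<le> k * int (card (A \<inter> B)) - l"
    using sub by (intro indep_bound X AB) auto
  moreover have "int (card (spanned X (A \<union> B))) \<le> k * int (card (A \<union> B)) - l"
    using sub by (intro indep_bound X large) auto
  moreover have "k * int (card A) + k * int (card B)
      = k * int (card (A \<union> B)) + k * int (card (A \<inter> B))"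
    using card_Un_Int[OF fin] by (metis distrib_left of_nat_add)
  ultimately have "int (card (spanned X (A \<union> B))) = k * int (card (A \<union> B)) - l"
    using A B unfolding saturated_def by linarith
  then show ?thesis
    using large sub by (auto simp: saturated_def)
qed

lemma finite_blocks: "finite (blocks X)"
  by (rule finite_subset[of _ "Pow (verts K)"])
    (auto simp: blocks_def saturated_def finite_verts)

lemma saturated_subset_block:
  assumes "saturated X V"
  shows "\<exists>B \<in> blocks X. V \<subseteq> B"
proof -
  have "finite {W. saturated X W}"
    by (rule finite_subset[of _ "Pow (verts K)"]) (auto simp: saturated_def finite_verts)
  from finite_has_maximal2[OF this, of V] assms show ?thesis
    by (auto simp: blocks_def)
qed

lemma blocks_inter_small:
  assumes "indep X" "A \<in> blocks X" "B \<in> blocks X" "A \<noteq> B"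
  shows "k * int (card (A \<inter> B)) \<le> l"
proof (rule ccontr)
  assume "\<not> ?thesis"
  then have "saturated X (A \<union> B)"
    using assms by (intro saturated_Un) (auto simp: blocks_def)
  then have "A \<union> B = A" "A \<union> B = B"
    using assms(2,3) unfolding blocks_def by blast+
  with assms(4) show False by simp
qed

text \<open>The form in which maximality of blocks is applied: \<open>D\<close> will be the end set
  of an edge, a single vertex, or a pair of vertices.\<close>

lemma block_unique:
  assumes "indep X" "A \<in> blocks X" "B \<in> blocks X"
    and "l < k * int (card D)" "D \<subseteq> A" "D \<subseteq> B"
  shows "A = B"
proof (rule ccontr)
  assume "A \<noteq> B"
  then have "k * int (card (A \<inter> B)) \<le> l"
    using blocks_inter_small assms by blast
  moreover have "l < k * int (card (A \<inter> B))"
    using assms by (auto intro!: large_mono[OF assms(4)] simp: blocks_def saturated_def)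
  ultimately show False by simp
qed

text \<open>Two blocks of \<open>X\<close> cannot share the ends of any edge of \<open>K\<close>,
  whether or not it lies in \<open>X\<close>. Hence the count also applies to a set \<open>Y\<close>
  that is compared with \<open>X\<close>.\<close>

lemma card_covered:
  assumes "indep X" "Y \<subseteq> edges K"
  shows "card (\<Union>B \<in> blocks X. spanned Y B) = (\<Sum>B \<in> blocks X. card (spanned Y B))"
proof (rule card_UN_disjoint[OF finite_blocks])
  show "\<forall>B \<in> blocks X. finite (spanned Y B)"
    using finite_spanned assms by blast
  show "\<forall>A \<in> blocks X. \<forall>B \<in> blocks X. A \<noteq> B \<longrightarrow> spanned Y A \<inter> spanned Y B = {}"
  proof (intro ballI impI equals0I)
    fix A B e assume *: "A \<in> blocks X" "B \<in> blocks X" "A \<noteq> B" "e \<in> spanned Y A \<inter> spanned Y B"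
    then have "l < k * int (card (ends K e))" "ends K e \<subseteq> A" "ends K e \<subseteq> B"
      using assms edge_large by (auto simp: spanned_def)
    with * assms block_unique show False by blast
  qed
qed

text \<open>A vertex set violating the bound after \<open>e\<close> is added must contain the ends
  of \<open>e\<close>. One edge raises its count by at most one, so \<open>X\<close> already
  saturates it.\<close>

lemma dependent_edge_in_block:
  assumes X: "indep X" and e: "e \<in> edges K" "\<not> indep (insert e X)"
  shows "\<exists>B \<in> blocks X. ends K e \<subseteq> B"
proof -
  have XK: "X \<subseteq> edges K" using X by (simp add: indep_def)
  with e obtain V where V: "V \<subseteq> verts K"
    and gt: "max 0 (k * int (card V) - l) < int (card (spanned (insert e X) V))"
    by (auto simp: indep_def not_le)
  have le: "int (card (spanned X V)) \<le> max 0 (k * int (card V) - l)"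
    using X V by (simp add: indep_def)
  have eV: "ends K e \<subseteq> V"
  proof (rule ccontr)
    assume "\<not> ?thesis"
    then have "spanned (insert e X) V = spanned X V" by (auto simp: spanned_def)
    with gt le show False by (metis leD)
  qed
  have large: "l < k * int (card V)"
    using large_mono[OF edge_large[OF e(1)] eV V] .
  have "spanned (insert e X) V = insert e (spanned X V)"
    using eV by (auto simp: spanned_def)
  then have "card (spanned (insert e X) V) \<le> Suc (card (spanned X V))"
    by (simp add: card_insert_if finite_spanned[OF XK])
  then have "int (card (spanned X V)) = k * int (card V) - l"
    using gt le large by linarith
  then have "saturated X V"
    using V large by (simp add: saturated_def)
  then obtain B where "B \<in> blocks X" "V \<subseteq> B"
    using saturated_subset_block by blast
  with eV show ?thesis by blast
qed

section \<open>Exchange property and the matroid axioms\<close>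

lemma augmentation:
  assumes X: "indep X" and Y: "indep Y" and less: "card X < card Y"
  shows "\<exists>e \<in> Y - X. indep (insert e X)"
proof (rule ccontr)
  assume "\<not> ?thesis"
  then have dep: "\<not> indep (insert e X)" if "e \<in> Y - X" for e
    using that by blast
  have XK: "X \<subseteq> edges K" and YK: "Y \<subseteq> edges K"
    using X Y by (auto simp: indep_def)
  have fin: "finite X" "finite Y"
    using XK YK finite_edges finite_subset by blast+
  define CX where "CX = (\<Union>B \<in> blocks X. spanned X B)"
  define CY where "CY = (\<Union>B \<in> blocks X. spanned Y B)"
  have sub: "CX \<subseteq> X" "CY \<subseteq> Y"
    by (auto simp: CX_def CY_def spanned_def)
  \<comment> \<open>An edge of \<open>Y\<close> outside all blocks could be added to
    \<open>X\<close>, so by assumption it is already in \<open>X\<close>.\<close>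
  have "Y - CY \<subseteq> X - CX"
  proof
    fix e assume e: "e \<in> Y - CY"
    then have "\<not> (\<exists>B \<in> blocks X. ends K e \<subseteq> B)"
      by (auto simp: CY_def spanned_def)
    then show "e \<in> X - CX"
      using e dep dependent_edge_in_block[OF X, of e] YK
      by (auto simp: CX_def spanned_def)
  qed
  then have "card (Y - CY) \<le> card (X - CX)"
    using fin by (intro card_mono) auto
  \<comment> \<open>Inside each block \<open>X\<close> attains the bound that \<open>Y\<close> has
    to obey.\<close>
  moreover have "card CY \<le> card CX"
    unfolding CX_def CY_def card_covered[OF X XK] card_covered[OF X YK]
  proof (rule sum_mono)
    fix B assume "B \<in> blocks X"
    then have "saturated X B" by (simp add: blocks_def)
    then show "card (spanned Y B) \<le> card (spanned X B)"
      using indep_bound[OF Y, of B] by (simp add: saturated_def)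
  qed
  moreover have "card X = card CX + card (X - CX)" "card Y = card CY + card (Y - CY)"
    using sub fin
    by (metis card_Diff_subset card_mono finite_subset le_add_diff_inverse)+
  ultimately show False using less by simp
qed

lemma matroid_indep: "matroid (edges K) {X. indep X}"
  unfolding matroid_def
proof (intro conjI)
  show "finite (edges K)" by (rule finite_edges)
  show "{X. indep X} \<subseteq> Pow (edges K)" by (auto simp: indep_def)
  show "{} \<in> {X. indep X}" by (simp add: indep_def spanned_def)
  show "\<forall>X \<in> {X. indep X}. \<forall>Y \<subseteq> X. Y \<in> {X. indep X}"
    using indep_subset by blast
  show "\<forall>X \<in> {X. indep X}. \<forall>Y \<in> {X. indep X}. card X < card Y \<longrightarrow>
      (\<exists>e \<in> Y - X. insert e X \<in> {X. indep X})"
    using augmentation by simp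
qed

section \<open>Bases and tight graphs\<close>

lemma end_class_in_block:
  assumes max: "X \<in> matroid_bases {X. indep X}"
    and D: "D \<subseteq> verts K" "l < k * int (card D)"
    and many: "k * int (card D) - l \<le> int (card {e \<in> edges K. ends K e = D})"
  shows "\<exists>B \<in> blocks X. D \<subseteq> B"
\<comment> \<open>Either all edges with end set \<open>D\<close> are in \<open>X\<close>, and by
  \<open>many\<close> they saturate \<open>D\<close>, or a missing one cannot be added by
  maximality.\<close>
proof (cases "{e \<in> edges K. ends K e = D} \<subseteq> X")
  case True
  have X: "indep X" using max by (simp add: matroid_bases_def)
  have "card {e \<in> edges K. ends K e = D} \<le> card (spanned X D)"
    using X True by (intro card_mono finite_spanned) (auto simp: indep_def spanned_def)
  then have "saturated X D"
    using D many indep_bound[OF X D] by (simp add: saturated_def)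
  then show ?thesis by (rule saturated_subset_block)
next
  case False
  then obtain e where e: "e \<in> edges K" "ends K e = D" "e \<notin> X" by blast
  then have "\<not> indep (insert e X)"
    using max by (auto simp: matroid_bases_def)
  with e max dependent_edge_in_block show ?thesis
    by (auto simp: matroid_bases_def)
qed

lemma sparse_iff_indep:
  assumes "subgraph_on (verts K) G K"
  shows "sparse k l G \<longleftrightarrow> indep (edges G)"
proof -
  have "spanned_edges G V = spanned (edges G) V" for V
    using assms by (auto simp: subgraph_on_def spanned_edges_def spanned_def)
  then show ?thesis
    using assms by (auto simp: sparse_def indep_def subgraph_on_def)
qed

lemma card_indep_le:
  assumes "indep X" "l \<le> k * int (card (verts K))"
  shows "int (card X) \<le> k * int (card (verts K)) - l"
proof -
  have "X \<subseteq> edges K"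
    using assms(1) by (simp add: indep_def)
  then have "spanned X (verts K) = X"
    using ends_subset by (auto simp: spanned_def)
  moreover have "int (card (spanned X (verts K))) \<le> max 0 (k * int (card (verts K)) - l)"
    using assms(1) unfolding indep_def by blast
  ultimately show ?thesis using assms(2) by simp
qed

text \<open>An independent set of size k|V| - l cannot be enlarged, by \<open>card_indep_le\<close>.
  That every base reaches this size can fail for a general \<open>K\<close>, so it is isolated as
  the hypothesis \<open>rank\<close>.\<close>

lemma matroid_bases_eq_tight:
  assumes nonneg: "l \<le> k * int (card (verts K))"
    and rank: "\<And>X. X \<in> matroid_bases {X. indep X} \<Longrightarrow>
      k * int (card (verts K)) - l \<le> int (card X)"
  shows "matroid_bases {X. indep X} = {edges G | G. subgraph_on (verts K) G K \<and> tight k l G}"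
    (is "?L = ?R")
proof (intro equalityI subsetI)
  fix X assume L: "X \<in> ?L"
  then have X: "indep X" by (simp add: matroid_bases_def)
  define G :: "('v, 'e) multigraph" where "G = \<lparr>verts = verts K, edges = X, ends = ends K\<rparr>"
  have XK: "X \<subseteq> edges K" using X by (simp add: indep_def)
  then have G: "subgraph_on (verts K) G K"
    using finite_K finite_subset[OF XK finite_edges]
    by (auto simp: G_def subgraph_on_def finite_multigraph_def)
  have "int (card X) = k * int (card (verts K)) - l"
    using rank[OF L] card_indep_le[OF X nonneg] by simp
  with G X sparse_iff_indep[OF G] have "tight k l G"
    by (simp add: tight_def G_def)
  with G show "X \<in> ?R" by (force simp: G_def)
next
  fix X assume "X \<in> ?R"
  then obtain G where G: "X = edges G" "subgraph_on (verts K) G K" "tight k l G" by blast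
  then have X: "indep X" and card: "int (card X) = k * int (card (verts K)) - l"
    using sparse_iff_indep by (auto simp: tight_def subgraph_on_def)
  have "Y = X" if Y: "indep Y" "X \<subseteq> Y" for Y
  proof (rule sym, rule card_subset_eq)
    show fin: "finite Y"
      using Y finite_edges finite_subset by (auto simp: indep_def)
    show "card X = card Y"
      using card_mono[OF fin Y(2)] card_indep_le[OF Y(1) nonneg] card by simp
  qed (rule Y(2))
  with X show "X \<in> ?L" by (auto simp: matroid_bases_def)
qed

end

section \<open>Pair counting in linear spaces\<close>

lemma card_off_diagonal:
  assumes "finite A"
  shows "int (card (A \<times> A - Id)) = int (card A) * (int (card A) - 1)"
proof -
  have "A \<times> A - Id = A \<times> A - (\<lambda>x. (x, x)) ` A" by auto
  moreover have "card (A \<times> A - (\<lambda>x. (x, x)) ` A) = card A * card A - card A"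
    using assms by (subst card_Diff_subset) (auto simp: card_cartesian_product card_image inj_on_def)
  moreover have "card A \<le> card A * card A" by simp
  ultimately show ?thesis by (simp add: of_nat_diff algebra_simps)
qed

lemma linear_space_excess:
  fixes k l n :: int and t :: "'b \<Rightarrow> int"
  assumes k: "0 \<le> k" and l: "l < 2 * k"
    and n: "n \<ge> 2" "n = 2 \<or> l \<le> (2 * k - l) * n"
    and t: "\<And>b. b \<in> S \<Longrightarrow> 2 \<le> t b \<and> t b \<le> n"
    and pairs: "(\<Sum>b \<in> S. t b * (t b - 1)) = n * (n - 1)"
  shows "k * n - l \<le> (\<Sum>b \<in> S. k * t b - l)"
proof -
  define p where "p = 2 * k - l"
  define c where "c = (\<Sum>b \<in> S. t b - 2) - (n - 2)"
  define r where "r = int (card S)"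
  have pos: "0 < p" using l by (simp add: p_def)
  have "(\<Sum>b \<in> S. t b * (t b - 1)) \<noteq> 0" using pairs n by auto
  \<comment> \<open>A sum over an infinite set is 0 by convention, so the nonzero pair sum also
    yields finiteness.\<close>
  then have "S \<noteq> {}" "finite S" by (auto intro: ccontr)
  then have r: "1 \<le> r" by (simp add: r_def Suc_le_eq card_gt_0_iff)
  \<comment> \<open>Each block is measured against a block of two vertices, whose contribution is
    \<open>p\<close>.\<close>
  have "(\<Sum>b \<in> S. k * t b - l) = (\<Sum>b \<in> S. k * (t b - 2) + p)"
    by (rule sum.cong) (auto simp: p_def algebra_simps)
  also have "\<dots> = k * (\<Sum>b \<in> S. t b - 2) + p * r"
    by (simp only: sum.distrib sum_distrib_left) (simp add: r_def)
  finally have excess: "(\<Sum>b \<in> S. k * t b - l) - (k * n - l) = k * c + p * (r - 1)"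
    by (simp add: c_def p_def algebra_simps)
  have "0 \<le> k * c + p * (r - 1)"
  proof (cases "0 \<le> c")
    case True
    with k pos r show ?thesis by simp
  next
    case False
    \<comment> \<open>For \<open>n = 2\<close> this would make \<open>c\<close> nonnegative, so the
      lower bound on \<open>n\<close> is available here.\<close>
    have "0 \<le> (\<Sum>b \<in> S. t b - 2)" using t by (intro sum_nonneg) auto
    with False have "n \<noteq> 2" by (auto simp: c_def)
    \<comment> \<open>Adding \<open>p = 2 * k - l\<close> to both sides of
      \<open>l \<le> p * n\<close>.\<close>
    with n have "2 * k \<le> p * (n + 1)" by (simp add: p_def algebra_simps)
    then have "p * (n + 1) * c \<le> 2 * k * c"
      using False by (intro mult_right_mono_neg) auto
    moreover have "0 \<le> p * ((n + 1) * c + 2 * (r - 1))"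
    proof -
      \<comment> \<open>Splitting t(t - 1) as (t + 1)(t - 2) + 2 allows t + 1 to be raised to n + 1.
        The same splitting of n(n - 1) then leaves exactly (n + 1)c + 2(r - 1).\<close>
      have "n * (n - 1) = (\<Sum>b \<in> S. (t b + 1) * (t b - 2) + 2)"
        unfolding pairs[symmetric] by (rule sum.cong) (auto simp: algebra_simps)
      also have "\<dots> \<le> (\<Sum>b \<in> S. (n + 1) * (t b - 2) + 2)"
        using t by (intro sum_mono add_right_mono mult_right_mono) auto
      also have "\<dots> = (n + 1) * (\<Sum>b \<in> S. t b - 2) + 2 * r"
        by (simp only: sum.distrib sum_distrib_left) (simp add: r_def)
      finally have "0 \<le> (n + 1) * c + 2 * (r - 1)"
        by (simp add: c_def algebra_simps)
      then show ?thesis using pos by simp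
    qed
    ultimately have "0 \<le> 2 * (k * c + p * (r - 1))"
      by (simp add: algebra_simps)
    then show ?thesis by simp
  qed
  with excess show ?thesis by simp
qed

section \<open>The complete multigraph\<close>

lemma complete_edge_class:
  assumes D: "D \<subseteq> {1..n}" "card D \<in> {1, 2}" and l: "l < k * int (card D)"
  shows "k * int (card D) - l \<le>
    int (card {e \<in> edges (complete_multigraph k l n). ends (complete_multigraph k l n) e = D})"
\<comment> \<open>The multiplicities of loops and of parallel edges are k|D| - l for |D| = 1 and |D|
  = 2, just enough for \<open>end_class_in_block\<close>.\<close>
proof (cases "card D = 1")
  case True
  then obtain v where "D = {v}" by (auto simp: card_1_singleton_iff)
  with D l show ?thesis by (simp add: card_loops_complete)
next
  case False
  with D(2) obtain u v where uv: "D = {u, v}" "u \<noteq> v" by (auto simp: card_2_iff)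
  with D l have "u \<in> {1..n}" "v \<in> {1..n}" "l \<le> 2 * k" by auto
  with card_parallel_complete[OF this(1,2) uv(2) this(3)] uv show ?thesis
    by simp
qed

text \<open>Loops exist only when \<open>l < k\<close>, so \<open>edge_large\<close> holds for them
  too.\<close>

lemma sparsity_complete:
  assumes "0 \<le> l" "l < 2 * k"
  shows "sparsity (complete_multigraph k l n) k l"
proof
  fix e assume "e \<in> edges (complete_multigraph k l n)"
  then show "l < k * int (card (ends (complete_multigraph k l n) e))"
    using assms by (auto simp: complete_multigraph_def)
qed (use assms finite_multigraph_complete in auto)

text \<open>The inequality in \<open>cond\<close> is n \<ge> l/(2k - l) cleared of its
  denominator.\<close>

lemma complete_rank:
  assumes l: "0 \<le> l" "l < 2 * k" and n: "1 \<le> n"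
    and cond: "l \<le> k \<or> n = 2 \<or> (2 \<le> n \<and> l \<le> (2 * k - l) * int n)"
    and base: "X \<in> matroid_bases {X. sparsity.indep (complete_multigraph k l n) k l X}"
  shows "k * int n - l \<le> int (card X)"
proof -
  let ?K = "complete_multigraph k l n"
  interpret sparsity ?K k l by (rule sparsity_complete[OF l])
  have verts: "verts ?K = {1..n}" by (simp add: complete_multigraph_def)
  have X: "indep X" using base by (simp add: matroid_bases_def)
  then have XK: "X \<subseteq> edges ?K" by (simp add: indep_def)
  then have finX: "finite X" using finite_edges finite_subset by blast
  have cover: "\<exists>B \<in> blocks X. D \<subseteq> B"
    if "D \<subseteq> {1..n}" "card D \<in> {1, 2}" "l < k * int (card D)" for D
    using that verts by (intro end_class_in_block base complete_edge_class) auto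
  have pair: "\<exists>B \<in> blocks X. {u, v} \<subseteq> B"
    if "u \<in> {1..n}" "v \<in> {1..n}" "u \<noteq> v" for u v
    using that l by (intro cover) auto
  have block_sub: "B \<subseteq> {1..n}" if "B \<in> blocks X" for B
    using that verts by (auto simp: blocks_def saturated_def)
  have block_card: "int (card (spanned X B)) = k * int (card B) - l" "l < k * int (card B)"
    if "B \<in> blocks X" for B
    using that by (auto simp: blocks_def saturated_def)
  consider "l < k" | "k \<le> l" "n = 1" | "k \<le> l" "2 \<le> n" using n by linarith
  then show ?thesis
  proof cases
    case 1
    \<comment> \<open>A single vertex already determines its block, so the block of vertex 1 absorbs
      every vertex paired with 1.\<close>
    obtain B where B: "B \<in> blocks X" "{1} \<subseteq> B"
      using cover[of "{1}"] 1 n by auto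
    have "v \<in> B" if v: "v \<in> {1..n}" for v
    proof (cases "v = 1")
      case False
      then obtain C where C: "C \<in> blocks X" "{1, v} \<subseteq> C"
        using pair[of 1 v] v n by auto
      then have "B = C"
        using B 1 by (intro block_unique[OF X, of _ _ "{1}"]) auto
      with C show ?thesis by simp
    qed (use B in simp)
    then have "B = {1..n}" using block_sub[OF B(1)] by blast
    then have "k * int n - l = int (card (spanned X B))"
      using block_card[OF B(1)] by simp
    also have "\<dots> \<le> int (card X)"
      using finX by (simp add: spanned_def card_mono)
    finally show ?thesis .
  next
    case 2
    \<comment> \<open>Here \<open>cond\<close> forces \<open>l = k\<close>, and the claimed lower
      bound is 0.\<close>
    with cond l show ?thesis by auto
  next
    case 3
    have n_cond: "n = 2 \<or> l \<le> (2 * k - l) * int n"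
    proof (cases "l \<le> k")
      case True
      with 3 have "k = l" by simp
      then show ?thesis using 3 l by simp
    qed (use cond in auto)
    have fin: "finite B" if "B \<in> blocks X" for B
      using block_sub[OF that] by (rule finite_subset) simp
    have t: "2 \<le> int (card B) \<and> int (card B) \<le> int n" if "B \<in> blocks X" for B
    proof
      show "2 \<le> int (card B)"
      proof (rule ccontr)
        assume "\<not> ?thesis"
        then have "k * int (card B) \<le> k * 1" using l by (intro mult_left_mono) auto
        with block_card(2)[OF that] 3 show False by simp
      qed
      show "int (card B) \<le> int n"
        using card_mono[OF _ block_sub[OF that]] by simp
    qed
    \<comment> \<open>The blocks partition the ordered pairs of distinct vertices:
      \<open>pair\<close> gives covering, and \<open>l < 2 * k\<close> gives uniqueness through
      \<open>block_unique\<close>.\<close>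
    have "{1..n} \<times> {1..n} - Id = (\<Union>B \<in> blocks X. B \<times> B - Id)"
    proof (intro equalityI subsetI)
      fix z assume "z \<in> {1..n} \<times> {1..n} - Id"
      then obtain u v where z: "z = (u, v)" "u \<in> {1..n}" "v \<in> {1..n}" "u \<noteq> v" by blast
      then obtain B where "B \<in> blocks X" "{u, v} \<subseteq> B" using pair by blast
      with z show "z \<in> (\<Union>B \<in> blocks X. B \<times> B - Id)" by blast
    qed (use block_sub in blast)
    moreover have "card (\<Union>B \<in> blocks X. B \<times> B - Id) = (\<Sum>B \<in> blocks X. card (B \<times> B - Id))"
    proof (rule card_UN_disjoint[OF finite_blocks])
      show "\<forall>B \<in> blocks X. finite (B \<times> B - Id)"
        using fin by simp
      show "\<forall>A \<in> blocks X. \<forall>B \<in> blocks X. A \<noteq> B \<longrightarrow> (A \<times> A - Id) \<inter> (B \<times> B - Id) = {}"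
      proof (intro ballI impI equals0I)
        fix A B z assume *: "A \<in> blocks X" "B \<in> blocks X" "A \<noteq> B"
          "z \<in> (A \<times> A - Id) \<inter> (B \<times> B - Id)"
        then obtain u v where "u \<noteq> v" "{u, v} \<subseteq> A" "{u, v} \<subseteq> B" by (cases z) auto
        then have "A = B"
          using * l by (intro block_unique[OF X, of _ _ "{u, v}"]) auto
        with * show False by simp
      qed
    qed
    ultimately have "int (card ({1..n} \<times> {1..n} - Id)) = (\<Sum>B \<in> blocks X. int (card (B \<times> B - Id)))"
      by simp
    also have "\<dots> = (\<Sum>B \<in> blocks X. int (card B) * (int (card B) - 1))"
      by (intro sum.cong card_off_diagonal fin) auto
    finally have pairs: "(\<Sum>B \<in> blocks X. int (card B) * (int (card B) - 1)) = int n * (int n - 1)"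
      by (simp add: card_off_diagonal)
    have "k * int n - l \<le> (\<Sum>B \<in> blocks X. k * int (card B) - l)"
      using 3 n_cond l t pairs by (intro linear_space_excess) auto
    also have "\<dots> = int (\<Sum>B \<in> blocks X. card (spanned X B))"
      using block_card(1) by simp
    also have "\<dots> = int (card (\<Union>B \<in> blocks X. spanned X B))"
      by (simp only: card_covered[OF X XK])
    also have "\<dots> \<le> int (card X)"
      using finX by (intro of_nat_mono card_mono) (auto simp: spanned_def)
    finally show ?thesis .
  qed
qed

theorem theorem2:
  fixes k l :: int and n :: nat
  assumes "k \<ge> 1" and "n \<ge> 1"
    and "(0 \<le> l \<and> l \<le> k \<and> n \<ge> 1)
       \<or> (k < l \<and> real_of_int l < 3 / 2 * real_of_int k \<and> n \<ge> 2)
       \<or> (3 / 2 * real_of_int k \<le> real_of_int l \<and> l < 2 * k \<and>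
          (n = 2 \<or> real n \<ge> real_of_int l / real_of_int (2 * k - l)))"
  shows "\<exists>\<I>. matroid (edges (complete_multigraph k l n)) \<I> \<and>
    matroid_bases \<I> =
      {edges G | G :: (nat, nat set \<times> nat) multigraph.
         subgraph_on {1..n} G (complete_multigraph k l n) \<and> tight k l G}"
proof -
  let ?K = "complete_multigraph k l n"
  have l: "0 \<le> l" "l < 2 * k" using assms by linarith+
  have cond: "l \<le> k \<or> n = 2 \<or> (2 \<le> n \<and> l \<le> (2 * k - l) * int n)"
    using assms(3)
  proof (elim disjE conjE)
    assume *: "k < l" "real_of_int l < 3 / 2 * real_of_int k" "n \<ge> 2"
    have "l \<le> (2 * k - l) * int n" if "n \<noteq> 2"
    proof -
      \<comment> \<open>The inequality 2l \<le> 3k is equivalent to l \<le> 3(2k - l), so the bound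
        on \<open>n\<close> holds from \<open>n = 3\<close> on.\<close>
      have "real_of_int (2 * l) < real_of_int (3 * k)" using *(2) by simp
      then have "2 * l < 3 * k" by (simp only: of_int_less_iff)
      then have "l \<le> (2 * k - l) * 3" by simp
      also have "\<dots> \<le> (2 * k - l) * int n"
        using that * l by (intro mult_left_mono) auto
      finally show ?thesis .
    qed
    with * show ?thesis by blast
  next
    assume *: "3 / 2 * real_of_int k \<le> real_of_int l"
      "real_of_int l / real_of_int (2 * k - l) \<le> real n"
    have "0 < real_of_int (2 * k - l)" using l by simp
    then have "real_of_int l \<le> real n * real_of_int (2 * k - l)"
      using *(2) by (simp only: pos_divide_le_eq)
    then have "real_of_int l \<le> real_of_int ((2 * k - l) * int n)"
      by (simp add: mult.commute)
    then have le: "l \<le> (2 * k - l) * int n" by (simp only: of_int_le_iff)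
    \<comment> \<open>For \<open>n = 1\<close> the inequality \<open>le\<close> would give
      \<open>l \<le> k\<close>, contrary to 3k/2 \<le> l with k positive.\<close>
    have "n \<noteq> 1" using le * assms(1) by auto
    with le assms(2) show ?thesis by auto
  qed auto
  interpret sparsity ?K k l by (rule sparsity_complete[OF l])
  have verts: "verts ?K = {1..n}" by (simp add: complete_multigraph_def)
  have "l \<le> k * int n"
  proof (cases "l \<le> k")
    case True
    have "k * 1 \<le> k * int n" using assms by (intro mult_left_mono) auto
    with True show ?thesis by simp
  next
    case False
    have "k * 2 \<le> k * int n" using assms(1) False cond by (intro mult_left_mono) auto
    with l show ?thesis by linarith
  qed
  then have "matroid_bases {X. indep X} = {edges G | G. subgraph_on (verts ?K) G ?K \<and> tight k l G}"
    using complete_rank[OF l assms(2) cond] by (intro matroid_bases_eq_tight) (simp_all add: verts)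
  with matroid_indep verts show ?thesis by auto
qed

end
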